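(* Let $W$ be a finite real reflection group with set of reflections $T$ and reflection length function $\ell_T$. Let $w\in W$ with $\ell_T(w)=\ell$. Then every factorization of $w$ into $m$ reflections lies in the Hurwitz orbit of some $\mathbf{t}=(t_1,\ldots,t_m)$ such that $t_1=t_2,\ t_3=t_4,\ \ldots,\ t_{m-\ell-1}=t_{m-\ell}$, and $(t_{m-\ell+1},\ldots,t_m)$ is a shortest reflection factorization of $w$.
   Context: A finite real reflection group $W$ is a finite group of linear maps of a finite-dimensional real Euclidean space $V$ generated by orthogonal reflections through hyperplanes (assumed to have no nonzero fixed vector in $V$); $T$ is the set of all reflections in $W$. The absolute (reflection) length of $w\in W$ is $\ell_T(w):=\min\{\ell: w=t_1t_2\cdots t_\ell \text{ for some } t_i\in T\}$ (with $\ell_T(e)=0$). A reflection factorization $w=t_1\cdots t_k$ ($t_i\in T$) is shortest if $k=\ell_T(w)$. Hurwitz action: write $a^b:=b^{-1}ab$. For $1\le i\le m-1$ the Hurwitz move $\sigma_i$ sends $(t_1,\ldots,t_m)$ to $(t_1,\ldots,t_{i-1},\,t_{i+1},\,t_i^{t_{i+1}},\,t_{i+2},\ldots,t_m)$. It is invertible and preserves the product. The Hurwitz orbit of a tuple is the set of tuples obtained from it by finite sequences of moves $\sigma_i^{\pm1}$. *)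

theory Defs
  imports "HOL-Analysis.Analysis" "HOL-Algebra.Generated_Groups"
begin

section \<open>Hurwitz action on tuples of group elements\<close>

text \<open>The case \<open>xs = [t\<^sub>1, \<dots>, t\<^sub>i\<^sub>-\<^sub>1]\<close>, \<open>a = t\<^sub>i\<close>, \<open>b = t\<^sub>i\<^sub>+\<^sub>1\<close> is the Hurwitz move \<open>\<sigma>\<^sub>i\<close>.\<close>

inductive hurwitz_move :: "('a, 'b) monoid_scheme \<Rightarrow> 'a list \<Rightarrow> 'a list \<Rightarrow> bool" for G where
  "\<lbrakk>set (xs @ a # b # ys) \<subseteq> carrier G\<rbrakk> \<Longrightarrow>
     hurwitz_move G (xs @ a # b # ys) (xs @ b # (inv\<^bsub>G\<^esub> b \<otimes>\<^bsub>G\<^esub> a \<otimes>\<^bsub>G\<^esub> b) # ys)"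

text \<open>Each \<open>\<sigma>\<^sub>i\<close> is injective on tuples over the carrier, so the converse of \<^const>\<open>hurwitz_move\<close>
  consists of the moves \<open>\<sigma>\<^sub>i\<close> inverted, and the equivalence closure is reachability by
  finite sequences of moves and inverse moves.\<close>

definition hurwitz_orbit :: "('a, 'b) monoid_scheme \<Rightarrow> 'a list \<Rightarrow> 'a list set" where
  "hurwitz_orbit G ts = {us. equivclp (hurwitz_move G) ts us}"

section \<open>Finite real reflection groups\<close>

text \<open>The ambient space is a type of class \<^class>\<open>real_inner\<close>, with finite dimension imposed as a
  hypothesis; \<^class>\<open>euclidean_space\<close> would exclude the zero space and hence the trivial group.\<close>

definition general_linear :: "('v::real_vector \<Rightarrow> 'v) monoid" where
  "general_linear = \<lparr>carrier = {f. linear f \<and> bij f}, monoid.mult = (\<circ>), one = id\<rparr>"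

definition hyperplane_reflection :: "'v::real_inner \<Rightarrow> 'v \<Rightarrow> 'v" where
  "hyperplane_reflection \<alpha> x = x - (2 * (x \<bullet> \<alpha>) / (\<alpha> \<bullet> \<alpha>)) *\<^sub>R \<alpha>"

definition reflections :: "('v::real_inner \<Rightarrow> 'v) set \<Rightarrow> ('v \<Rightarrow> 'v) set" where
  "reflections W = {t \<in> W. \<exists>\<alpha>. \<alpha> \<noteq> 0 \<and> t = hyperplane_reflection \<alpha>}"

definition finite_reflection_group :: "('v::real_inner \<Rightarrow> 'v) set \<Rightarrow> bool" where
  "finite_reflection_group W \<longleftrightarrow>
     (\<exists>B. finite_dimensional_vector_space ((*\<^sub>R) :: real \<Rightarrow> 'v \<Rightarrow> 'v) B) \<and>
     subgroup W general_linear \<and>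
     finite W \<and>
     generate general_linear (reflections W) = W \<and>
     (\<forall>v. (\<forall>f\<in>W. f v = v) \<longrightarrow> v = 0)"

definition reflection_factorization ::
  "('v::real_inner \<Rightarrow> 'v) set \<Rightarrow> ('v \<Rightarrow> 'v) \<Rightarrow> ('v \<Rightarrow> 'v) list \<Rightarrow> bool" where
  "reflection_factorization W w ts \<longleftrightarrow> set ts \<subseteq> reflections W \<and> w = foldr (\<circ>) ts id"

definition reflection_length :: "('v::real_inner \<Rightarrow> 'v) set \<Rightarrow> ('v \<Rightarrow> 'v) \<Rightarrow> nat" where
  "reflection_length W w = (LEAST k. \<exists>ts. length ts = k \<and> reflection_factorization W w ts)"

definition shortest_reflection_factorization ::
  "('v::real_inner \<Rightarrow> 'v) set \<Rightarrow> ('v \<Rightarrow> 'v) \<Rightarrow> ('v \<Rightarrow> 'v) list \<Rightarrow> bool" where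
  "shortest_reflection_factorization W w ts \<longleftrightarrow>
     reflection_factorization W w ts \<and> length ts = reflection_length W w"

lemma group_general_linear: "group (general_linear :: ('v::real_vector \<Rightarrow> 'v) monoid)"
proof (rule groupI)
  fix f :: "'v \<Rightarrow> 'v" assume "f \<in> carrier general_linear"
  then have f: "linear f" "bij f" by (auto simp: general_linear_def)
  obtain g where g: "linear g" "g \<circ> f = id"
    using linear_injective_left_inverse[OF f(1) bij_is_inj[OF f(2)]] by blast
  have "f \<circ> g = id"
  proof
    fix y
    obtain x where "y = f x" using bij_is_surj[OF f(2)] by (rule surjE)
    then show "(f \<circ> g) y = id y" using fun_cong[OF g(2), of x] by simp
  qed
  then have "bij g" using g(2) by (rule o_bij)
  with g show "\<exists>g\<in>carrier general_linear. g \<otimes>\<^bsub>general_linear\<^esub> f = \<one>\<^bsub>general_linear\<^esub>"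
    by (auto simp: general_linear_def)
qed (auto simp: general_linear_def linear_compose bij_comp comp_assoc linear_id)

lemma hyperplane_reflection_involution:
  "hyperplane_reflection \<alpha> \<circ> hyperplane_reflection \<alpha> = id"
proof
  fix x :: 'a
  show "(hyperplane_reflection \<alpha> \<circ> hyperplane_reflection \<alpha>) x = id x"
    by (cases "\<alpha> = 0") (simp_all add: hyperplane_reflection_def inner_diff_left)
qed

lemma linear_hyperplane_reflection: "linear (hyperplane_reflection \<alpha>)"
  by (rule linearI)
     (auto simp: hyperplane_reflection_def algebra_simps add_divide_distrib)

lemma hyperplane_reflection_in_general_linear:
  "hyperplane_reflection \<alpha> \<in> carrier general_linear"
  by (auto simp: general_linear_def linear_hyperplane_reflection
      intro!: o_bij[of "hyperplane_reflection \<alpha>"] hyperplane_reflection_involution)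

end

theory Submission
  imports Defs
begin

text \<open>
  A factorization with two equal neighbours \<open>t, t\<close> is Hurwitz equivalent to one in which that pair
  stands in front, and the rest is a factorization of the same element that is shorter by two. By
  induction on the length it is therefore enough to show that a factorization is shortest as soon
  as no member of its Hurwitz orbit has two equal neighbours; such orbits are called square-free.

  The heart of the matter is that in a square-free orbit every vector \<open>v\<close> fixed by the product
  \<open>w = t\<^sub>1\<dots>t\<^sub>m\<close> is fixed by each \<open>t\<^sub>i\<close> (\<open>reflections_fix_fixed_vectors\<close>). For a vector \<open>p\<close> that lies
  on no mirror, put \<open>f(x) = x p \<bullet> p\<close>, a stand-in for minus the Coxeter length with respect to the
  chamber of \<open>p\<close>, and choose a member of the finite orbit for which the sum of \<open>f\<close> over the prefix
  products \<open>x\<^sub>i = t\<^sub>1\<dots>t\<^sub>i\<close> is largest. If \<open>f(x\<^sub>i)\<close> were smaller than both \<open>f(x\<^sub>i\<^sub>-\<^sub>1)\<close> and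
  \<open>f(x\<^sub>i\<^sub>+\<^sub>1)\<close>, then an inequality in the dihedral group of \<open>t\<^sub>i\<close> and \<open>t\<^sub>i\<^sub>+\<^sub>1\<close>
  (\<open>rotation_beats_two_improving_reflections\<close>) would show that a single Hurwitz move at this place
  increases the sum. So \<open>f\<close> has no valley along the path, and since it attains its maximum at the
  starting point \<open>id\<close>, it decreases strictly all the way; in particular \<open>f(x\<^sub>i) \<ge> f(w)\<close> for all \<open>i\<close>.
  Now let \<open>p\<close> be very close to \<open>v\<close>. Then \<open>f(w)\<close> is close to \<open>v \<bullet> v\<close>, while \<open>f(x)\<close> stays away from it
  for those \<open>x\<close> that move \<open>v\<close>. Hence all \<open>x\<^sub>i\<close> fix \<open>v\<close>, and so do all \<open>t\<^sub>i\<close>. The vectors fixed by a whole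
  tuple do not change under Hurwitz moves, so this carries over to the given factorization.

  What remains is linear algebra in the style of Carter. A nonzero vector \<open>b\<close> in the image of
  \<open>w\<^sub>0 - 1\<close> gives a vector fixed by the product of \<open>w\<^sub>0\<close> with the reflection in \<open>b\<close>, but not by that
  reflection (\<open>new_fixed_vector_of_root_in_image\<close>). Together with the previous paragraph this shows, one
  factor at a time, that the roots (nonzero normal vectors of the mirrors) of a factorization with
  square-free orbit are linearly independent and lie in the image of \<open>w - 1\<close>. That image is contained
  in the span of the roots of any other factorization of \<open>w\<close>, which then cannot be shorter.
\<close>

section \<open>Reflections and their products\<close>

definition composite :: "('v \<Rightarrow> 'v) list \<Rightarrow> 'v \<Rightarrow> 'v" where
  "composite ts = foldr (\<circ>) ts id"

lemma composite_simps [simp]: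
  "composite [] = id"
  "composite (t # ts) = t \<circ> composite ts"
  by (simp_all add: composite_def)

lemma composite_append [simp]: "composite (xs @ ys) = composite xs \<circ> composite ys"
  by (induction xs) (simp_all add: comp_assoc)

lemma hyperplane_reflection_twice [simp]:
  "hyperplane_reflection a (hyperplane_reflection a x) = x"
  using fun_cong[OF hyperplane_reflection_involution[of a], of x] by simp

lemma hyperplane_reflection_self_adjoint:
  "hyperplane_reflection a x \<bullet> y = x \<bullet> hyperplane_reflection a y"
  by (simp add: hyperplane_reflection_def inner_diff_left inner_diff_right inner_commute)

lemma hyperplane_reflection_fixes_iff:
  "hyperplane_reflection a x = x \<longleftrightarrow> x \<bullet> a = 0"
  by (auto simp: hyperplane_reflection_def)

lemma hyperplane_reflection_scaleR:
  assumes "c \<noteq> 0"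
  shows "hyperplane_reflection (c *\<^sub>R a) = hyperplane_reflection a"
  using assms by (auto simp: hyperplane_reflection_def fun_eq_iff)

lemma composite_adjoint:
  assumes "set ts \<subseteq> range hyperplane_reflection"
  shows "composite ts x \<bullet> y = x \<bullet> composite (rev ts) y"
  using assms
  by (induction ts arbitrary: x y)
     (auto simp: hyperplane_reflection_self_adjoint)

lemma composite_rev:
  assumes "set ts \<subseteq> range hyperplane_reflection"
  shows "composite ts (composite (rev ts) x) = x"
  using assms
  by (induction ts arbitrary: x) auto

lemma linear_composite:
  assumes "set ts \<subseteq> range hyperplane_reflection"
  shows "linear (composite ts)"
  using assms
  by (induction ts) (auto intro!: linear_compose linear_hyperplane_reflection simp: linear_id)

lemma continuous_composite:
  assumes "set ts \<subseteq> range hyperplane_reflection"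
  shows "continuous_on UNIV (composite ts)"
  using assms
proof (induction ts)
  case (Cons t ts)
  then obtain a where a: "t = hyperplane_reflection a" by auto
  have "continuous_on UNIV (composite ts)" by (rule Cons.IH) (use Cons.prems in auto)
  then have "continuous_on UNIV (\<lambda>x. hyperplane_reflection a (composite ts x))"
    unfolding hyperplane_reflection_def by (cases "a = 0") (simp, intro continuous_intros, simp_all)
  then show ?case unfolding a composite_simps o_def .
qed (simp add: id_def)

lemma norm_composite:
  assumes "set ts \<subseteq> range hyperplane_reflection"
  shows "norm (composite ts x) = norm x"
proof -
  have "composite (rev ts) (composite ts x) = x"
    using composite_rev[of "rev ts" x] assms by simp
  then show ?thesis
    by (simp add: norm_eq_sqrt_inner composite_adjoint[OF assms])
qed

lemma conjugate_hyperplane_reflection: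
  assumes "set ts \<subseteq> range hyperplane_reflection"
  shows "composite ts \<circ> hyperplane_reflection a \<circ> composite (rev ts) =
         hyperplane_reflection (composite ts a)"
proof
  fix x
  have lin: "linear (composite ts)" by (rule linear_composite[OF assms])
  have "composite (rev ts) x \<bullet> a = x \<bullet> composite ts a"
    using composite_adjoint[OF assms, of a x] by (simp add: inner_commute)
  moreover have "composite ts a \<bullet> composite ts a = a \<bullet> a"
    using norm_composite[OF assms, of a] by (simp add: norm_eq_sqrt_inner)
  ultimately show "(composite ts \<circ> hyperplane_reflection a \<circ> composite (rev ts)) x =
         hyperplane_reflection (composite ts a) x"
    by (simp add: hyperplane_reflection_def linear_diff[OF lin] linear_scale[OF lin]
        composite_rev[OF assms])
qed

section \<open>The rank two inequality\<close>

lemma strict_Cauchy_Schwarz_of_distinct_reflections: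
  assumes "hyperplane_reflection a \<noteq> hyperplane_reflection b" "a \<noteq> 0" "b \<noteq> 0"
  shows "(a \<bullet> b)\<^sup>2 < (a \<bullet> a) * (b \<bullet> b)"
proof -
  define c where "c = (a \<bullet> b) / (a \<bullet> a)"
  have aa: "a \<bullet> a > 0" using assms by simp
  have "b \<noteq> c *\<^sub>R a"
    using assms hyperplane_reflection_scaleR[of c a] by (cases "c = 0") auto
  then have "0 < (b - c *\<^sub>R a) \<bullet> (b - c *\<^sub>R a)" by simp
  also have "\<dots> = b \<bullet> b - (a \<bullet> b)\<^sup>2 / (a \<bullet> a)"
    using aa by (simp add: inner_diff_left inner_diff_right inner_commute c_def field_simps power2_eq_square)
  finally show ?thesis using aa by (simp add: field_simps)
qed

lemma inner_hyperplane_reflection: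
  "hyperplane_reflection a p \<bullet> q = p \<bullet> q - 2 * ((p \<bullet> a) * (a \<bullet> q) / (a \<bullet> a))"
  by (simp add: hyperplane_reflection_def inner_diff_left)

text \<open>Project \<open>p\<close> and \<open>q\<close> to the plane spanned by \<open>a\<close> and \<open>b\<close>, where they enclose an angle
  \<open>\<gamma> \<le> \<pi>\<close>. A reflection brings \<open>p\<close> closer to \<open>q\<close> exactly when its mirror separates them, so both
  mirrors pass through the sector between \<open>p\<close> and \<open>q\<close> and enclose there an angle \<open>\<theta>\<close> with
  \<open>0 < \<theta> < \<gamma>\<close>. In one of the two orders, the product of the reflections rotates \<open>p\<close> by \<open>2\<theta>\<close> towards
  \<open>q\<close>, leaving the smaller angle \<open>\<bar>\<gamma> - 2\<theta>\<bar>\<close>. The proof is an algebraic version of this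
  picture: if neither rotation helped, then the inequality \<open>(X + Y)\<^sup>2 \<ge> 4XY\<close> for the half gains \<open>X\<close> and
  \<open>Y\<close> of the two reflections would contradict the strict Cauchy-Schwarz inequality for \<open>a\<close> and
  \<open>b\<close>.\<close>

lemma rotation_beats_two_improving_reflections:
  assumes ne: "hyperplane_reflection a \<noteq> hyperplane_reflection b"
    and a: "p \<bullet> q < hyperplane_reflection a p \<bullet> q"
    and b: "p \<bullet> q < hyperplane_reflection b p \<bullet> q"
  shows "p \<bullet> q < hyperplane_reflection a (hyperplane_reflection b p) \<bullet> q \<or>
         p \<bullet> q < hyperplane_reflection b (hyperplane_reflection a p) \<bullet> q"
proof (rule ccontr)
  assume neg: "\<not> ?thesis"
  have nz: "a \<noteq> 0" "b \<noteq> 0" using a b by (auto simp: inner_hyperplane_reflection)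
  define X where "X = - (p \<bullet> a) * (a \<bullet> q) / (a \<bullet> a)"
  define Y where "Y = - (p \<bullet> b) * (b \<bullet> q) / (b \<bullet> b)"
  define D where "D = (a \<bullet> a) * (b \<bullet> b)"
  define Z1 where "Z1 = (p \<bullet> b) * (a \<bullet> b) * (a \<bullet> q) / D"
  define Z2 where "Z2 = (p \<bullet> a) * (a \<bullet> b) * (b \<bullet> q) / D"
  have "X > 0" "Y > 0" using a b by (simp_all add: inner_hyperplane_reflection X_def Y_def)
  have D: "D > 0" using nz by (simp add: D_def)
  \<comment> \<open>The cross terms \<open>Z1\<close> and \<open>Z2\<close> depend on the order, but their product is \<open>XY\<close> times the
    squared cosine of the angle between \<open>a\<close> and \<open>b\<close>.\<close>
  have "hyperplane_reflection a (hyperplane_reflection b p) \<bullet> q = p \<bullet> q + 2 * (X + Y + 2 * Z1)"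
    using nz by (simp add: inner_hyperplane_reflection inner_commute[of b a] X_def Y_def Z1_def D_def field_simps)
  moreover have "hyperplane_reflection b (hyperplane_reflection a p) \<bullet> q = p \<bullet> q + 2 * (X + Y + 2 * Z2)"
    using nz by (simp add: inner_hyperplane_reflection inner_commute[of b a] X_def Y_def Z2_def D_def field_simps)
  ultimately have "X + Y \<le> - 2 * Z1" "X + Y \<le> - 2 * Z2" using neg by auto
  then have "(X + Y) * (X + Y) \<le> (- 2 * Z1) * (- 2 * Z2)"
    using \<open>X > 0\<close> \<open>Y > 0\<close> by (intro mult_mono) auto
  also have "\<dots> = 4 * (X * Y) * ((a \<bullet> b)\<^sup>2 / D)"
    using nz by (simp add: X_def Y_def Z1_def Z2_def D_def power2_eq_square)
  also have "\<dots> < 4 * (X * Y) * 1"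
  proof (rule mult_strict_left_mono)
    show "(a \<bullet> b)\<^sup>2 / D < 1"
      using strict_Cauchy_Schwarz_of_distinct_reflections[OF ne nz] D by (simp add: D_def)
    show "0 < 4 * (X * Y)" using \<open>X > 0\<close> \<open>Y > 0\<close> by simp
  qed
  finally have "(X - Y)\<^sup>2 < 0" by (simp add: power2_eq_square algebra_simps)
  then show False by simp
qed

section \<open>Orthogonal components and generic vectors\<close>

text \<open>Gram-Schmidt: subtract from \<open>s\<close> its component in the span of the earlier vectors, and project
  \<open>b\<close> along the difference \<open>n\<close>. If \<open>n = 0\<close>, division by zero makes the coefficient \<open>c\<close> vanish, as it
  should.\<close>

lemma orthogonal_component_exists:
  fixes S :: "'v::real_inner set"
  assumes "finite S"
  shows "\<exists>u\<in>span S. \<forall>s\<in>S. (b - u) \<bullet> s = 0"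
  using assms
proof (induction S arbitrary: b)
  case empty
  then show ?case by (auto intro: span_zero)
next
  case (insert s S)
  obtain u where u: "u \<in> span S" "\<And>x. x \<in> S \<Longrightarrow> (s - u) \<bullet> x = 0" using insert.IH[of s] by blast
  obtain v where v: "v \<in> span S" "\<And>x. x \<in> S \<Longrightarrow> (b - v) \<bullet> x = 0" using insert.IH[of b] by blast
  define n where "n = s - u"
  define c where "c = ((b - v) \<bullet> n) / (n \<bullet> n)"
  have sub: "span S \<subseteq> span (insert s S)" by (rule span_mono) auto
  have un: "(b - v - c *\<^sub>R n) \<bullet> u = 0"
  proof -
    have "orthogonal (b - v - c *\<^sub>R n) u"
      using u(1) by (rule orthogonal_to_span)
        (use u(2) v(2) in \<open>auto simp: orthogonal_def inner_diff_left n_def\<close>)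
    then show ?thesis by (simp add: orthogonal_def)
  qed
  have nn: "(b - v - c *\<^sub>R n) \<bullet> n = 0"
    by (cases "n = 0") (simp_all add: c_def inner_diff_left)
  have "(b - v - c *\<^sub>R n) \<bullet> (n + u) = 0"
    using un nn unfolding inner_add_right by simp
  then have "(b - v - c *\<^sub>R n) \<bullet> s = 0" by (simp add: n_def)
  moreover have "(b - v - c *\<^sub>R n) \<bullet> x = 0" if "x \<in> S" for x
    using u(2)[OF that] v(2)[OF that] by (simp add: inner_diff_left n_def)
  moreover have "v + c *\<^sub>R n \<in> span (insert s S)"
    unfolding n_def using subsetD[OF sub u(1)] subsetD[OF sub v(1)]
    by (intro span_add span_scale span_diff) (simp_all add: span_base)
  ultimately show ?case
    by (intro bexI[of _ "v + c *\<^sub>R n"]) (auto simp: algebra_simps)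
qed

text \<open>Hyperplanes are nowhere dense: a vector on the hyperplane orthogonal to \<open>b\<close> leaves it under any
  small shift along \<open>b\<close>, and stays off the finitely many hyperplanes treated before.\<close>

lemma generic_vector_exists:
  fixes B :: "'v::real_inner set"
  assumes "finite B" "0 \<notin> B" "open U" "v \<in> U"
  shows "\<exists>p\<in>U. \<forall>b\<in>B. p \<bullet> b \<noteq> 0"
  using assms
proof (induction B)
  case empty
  then show ?case by auto
next
  case (insert b B)
  then obtain p where p: "p \<in> U" "\<And>x. x \<in> B \<Longrightarrow> p \<bullet> x \<noteq> 0" by auto
  show ?case
  proof (cases "p \<bullet> b = 0")
    case False
    with p show ?thesis by auto
  next
    case True
    define U' where "U' = U \<inter> (\<Inter>x\<in>B. {p. p \<bullet> x \<noteq> 0})"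
    have "open U'" unfolding U'_def
      using insert.prems insert.hyps by (intro open_Int open_INT ballI open_Collect_neq continuous_intros) auto
    moreover have "p \<in> U'" using p by (auto simp: U'_def)
    ultimately obtain e where e: "e > 0" "ball p e \<subseteq> U'" by (meson open_contains_ball)
    define k where "k = e / (2 * norm b)"
    have b: "b \<noteq> 0" using insert.prems by auto
    have k: "k > 0" using e b by (simp add: k_def)
    have "dist p (p + k *\<^sub>R b) = e / 2" using e b by (simp add: dist_norm k_def)
    then have "p + k *\<^sub>R b \<in> U'" using e by (intro subsetD[OF e(2)]) simp
    moreover have "(p + k *\<^sub>R b) \<bullet> b \<noteq> 0" using True k b by (simp add: inner_add_left)
    ultimately show ?thesis by (auto simp: U'_def)
  qed
qed

section \<open>The image of a product of reflections minus the identity\<close>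

lemma composite_minus_id_in_span_roots:
  "composite (map hyperplane_reflection as) x - x \<in> span (set as)"
proof (induction as arbitrary: x)
  case Nil
  then show ?case by (simp add: span_zero)
next
  case (Cons a as)
  let ?y = "composite (map hyperplane_reflection as) x"
  have "hyperplane_reflection a ?y - ?y \<in> span (set (a # as))"
    by (simp add: hyperplane_reflection_def span_neg span_scale span_base)
  moreover have "?y - x \<in> span (set (a # as))"
    using Cons[of x] span_mono[of "set as" "set (a # as)"] by auto
  ultimately have "(hyperplane_reflection a ?y - ?y) + (?y - x) \<in> span (set (a # as))"
    by (rule span_add)
  then show ?case by simp
qed

lemma composite_fixes_orthogonal:
  assumes "\<And>a. a \<in> set as \<Longrightarrow> z \<bullet> a = 0"
  shows "composite (map hyperplane_reflection as) z = z"
  using assms by (induction as) (auto simp: hyperplane_reflection_fixes_iff)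

text \<open>Both \<open>x\<close> and its image \<open>v\<close> under the isometry have the same norm, so the reflection in their
  difference \<open>b = v - x\<close> exchanges them; composing, \<open>v\<close> is sent to \<open>x\<close> and back to \<open>v\<close>. The second
  conclusion says that for \<open>b \<noteq> 0\<close> the reflection itself moves \<open>v\<close>.\<close>

lemma new_fixed_vector_of_root_in_image:
  assumes ts: "set ts \<subseteq> range hyperplane_reflection"
    and b: "b = composite ts x - x"
  shows "composite ts (hyperplane_reflection b (composite ts x)) = composite ts x"
    and "composite ts x \<bullet> b = (b \<bullet> b) / 2"
proof -
  let ?v = "composite ts x"
  have norm: "?v \<bullet> ?v = x \<bullet> x"
    using norm_composite[OF ts, of x] by (simp add: norm_eq_sqrt_inner)
  show vb: "?v \<bullet> b = (b \<bullet> b) / 2"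
    unfolding b using norm by (simp add: inner_diff_left inner_diff_right inner_commute)
  have "hyperplane_reflection b ?v = x"
  proof (cases "b = 0")
    case True
    then show ?thesis using b by (simp add: hyperplane_reflection_def)
  next
    case False
    then have "2 * (?v \<bullet> b) / (b \<bullet> b) = 1" using vb by simp
    then have "hyperplane_reflection b ?v = ?v - b" by (simp only: hyperplane_reflection_def scaleR_one)
    then show ?thesis using b by simp
  qed
  then show "composite ts (hyperplane_reflection b ?v) = ?v" by simp
qed

text \<open>Let \<open>g\<close> be the product for \<open>as\<close>. The component \<open>z\<close> of \<open>b\<close> orthogonal to the roots in \<open>as\<close> is fixed
  by \<open>g\<close> and does not lie on the mirror of \<open>b\<close>. Hence any argument of \<open>g - 1\<close> can be moved onto that mirror by
  adding a multiple of \<open>z\<close>, without changing the value. On the mirror the new factor acts trivially, so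
  the image of \<open>g - 1\<close> survives in the new image; evaluating at \<open>b\<close> then yields \<open>b\<close> itself.\<close>

lemma roots_in_image_step:
  assumes im: "set as \<subseteq> range (\<lambda>x. composite (map hyperplane_reflection as) x - x)"
    and b: "b \<notin> span (set as)"
  shows "set (as @ [b]) \<subseteq> range (\<lambda>x. composite (map hyperplane_reflection (as @ [b])) x - x)"
proof -
  define g where "g = composite (map hyperplane_reflection as)"
  define I where "I = range (\<lambda>x. g (hyperplane_reflection b x) - x)"
  have lin: "linear g" unfolding g_def by (rule linear_composite) auto
  have linI: "linear (\<lambda>x. g (hyperplane_reflection b x) - x)"
    using linear_compose[OF linear_hyperplane_reflection lin]
    by (intro linear_compose_sub linear_ident) (simp add: o_def)
  have subI: "subspace I" unfolding I_def by (rule linear_subspace_image[OF linI subspace_UNIV])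
  obtain u where u: "u \<in> span (set as)" "\<And>a. a \<in> set as \<Longrightarrow> (b - u) \<bullet> a = 0"
    using orthogonal_component_exists[of "set as" b] by auto
  define z where "z = b - u"
  have gz: "g z = z" unfolding g_def z_def by (rule composite_fixes_orthogonal) (use u(2) in auto)
  have "z \<noteq> 0" using u(1) b by (auto simp: z_def)
  moreover have "z \<bullet> u = 0"
    using orthogonal_to_span[OF u(1), of z] u(2) by (auto simp: orthogonal_def z_def)
  then have "z \<bullet> b = z \<bullet> z" using inner_add_right[of z u z] by (simp add: z_def)
  ultimately have zb: "z \<bullet> b \<noteq> 0" by simp
  have old: "g x - x \<in> I" for x
  proof -
    define y where "y = x - ((x \<bullet> b) / (z \<bullet> b)) *\<^sub>R z"
    have "y \<bullet> b = 0" using zb by (simp add: y_def inner_diff_left)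
    then have "hyperplane_reflection b y = y" by (simp add: hyperplane_reflection_fixes_iff)
    moreover have "g y - y = g x - x"
      by (simp add: y_def linear_diff[OF lin] linear_scale[OF lin] gz)
    ultimately have "g x - x = g (hyperplane_reflection b y) - y" by simp
    then show ?thesis unfolding I_def by (rule range_eqI)
  qed
  have "b \<in> I"
  proof -
    have "b \<noteq> 0" using b span_zero by auto
    have "hyperplane_reflection b b = - b"
      using \<open>b \<noteq> 0\<close> by (simp add: hyperplane_reflection_def scaleR_2)
    then have "g (hyperplane_reflection b b) - b = - (g b - b) - 2 *\<^sub>R b"
      by (simp add: linear_neg[OF lin] scaleR_2)
    then have "2 *\<^sub>R b = - (g b - b) - (g (hyperplane_reflection b b) - b)"
      by (simp add: algebra_simps)
    also have "\<dots> \<in> I"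
    proof (rule subspace_diff[OF subI subspace_neg[OF subI old]])
      show "g (hyperplane_reflection b b) - b \<in> I" unfolding I_def by (rule rangeI)
    qed
    finally have "(1/2) *\<^sub>R (2 *\<^sub>R b) \<in> I" by (rule subspace_scale[OF subI])
    then show ?thesis by simp
  qed
  moreover have "set as \<subseteq> I" using im old by (auto simp: g_def)
  ultimately show ?thesis
    by (simp add: g_def I_def)
qed

lemma length_le_of_independent_roots:
  assumes "independent (set as)" "distinct as"
    and im: "set as \<subseteq> range (\<lambda>x. composite (map hyperplane_reflection as) x - x)"
    and eq: "composite (map hyperplane_reflection bs) = composite (map hyperplane_reflection as)"
  shows "length as \<le> length bs"
proof -
  have "set as \<subseteq> span (set bs)"
    using im composite_minus_id_in_span_roots[of bs] unfolding eq by auto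
  then have "card (set as) \<le> card (set bs)"
    using independent_span_bound[of "set bs" "set as"] assms(1) by auto
  also have "\<dots> \<le> length bs" by (rule card_length)
  finally show ?thesis using distinct_card[OF assms(2)] by simp
qed

section \<open>Hurwitz moves\<close>

lemma hurwitz_move_append:
  assumes "hurwitz_move G us vs" "set xs \<subseteq> carrier G" "set ys \<subseteq> carrier G"
  shows "hurwitz_move G (xs @ us @ ys) (xs @ vs @ ys)"
  using assms(1)
proof cases
  case (1 ps a b qs)
  then show ?thesis
    using hurwitz_move.intros[of "xs @ ps" a b "qs @ ys" G] assms(2,3) by simp
qed

lemma hurwitz_equiv_append:
  assumes "equivclp (hurwitz_move G) us vs" "set xs \<subseteq> carrier G" "set ys \<subseteq> carrier G"
  shows "equivclp (hurwitz_move G) (xs @ us @ ys) (xs @ vs @ ys)"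
  using assms(1)
proof (induction rule: equivclp_induct)
  case base
  then show ?case by (rule equivclp_refl)
next
  case (step y z)
  then have "hurwitz_move G (xs @ y @ ys) (xs @ z @ ys) \<or> hurwitz_move G (xs @ z @ ys) (xs @ y @ ys)"
    using hurwitz_move_append assms(2,3) by metis
  then have "equivclp (hurwitz_move G) (xs @ y @ ys) (xs @ z @ ys)"
    by (metis r_into_equivclp equivclp_sym)
  with step.IH show ?case by (rule equivclp_trans)
qed

lemma inv_hyperplane_reflection:
  "inv\<^bsub>general_linear\<^esub> (hyperplane_reflection a) = hyperplane_reflection a"
proof -
  interpret group "general_linear :: ('v::real_inner \<Rightarrow> 'v) monoid" by (rule group_general_linear)
  show ?thesis
    using hyperplane_reflection_involution[of a] hyperplane_reflection_in_general_linear[of a]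
    by (intro inv_equality) (auto simp: general_linear_def)
qed

abbreviation hurwitz_equiv (infix "\<sim>\<^sub>H" 50) where
  "us \<sim>\<^sub>H vs \<equiv> equivclp (hurwitz_move general_linear) us vs"

locale finite_linear_group =
  fixes W :: "('v::real_inner \<Rightarrow> 'v) set"
  assumes subgroup: "subgroup W general_linear" and finite: "finite W"
begin

lemma reflectionE:
  assumes "t \<in> reflections W"
  obtains a where "a \<noteq> 0" "t = hyperplane_reflection a"
  using assms by (auto simp: reflections_def)

lemma reflections_carrier: "reflections W \<subseteq> carrier general_linear"
  using subgroup.subset[OF subgroup] by (auto simp: reflections_def)

lemma reflections_range: "reflections W \<subseteq> range hyperplane_reflection"
  by (auto simp: reflections_def)

lemma finite_reflections: "finite (reflections W)"
  using finite by (auto simp: reflections_def)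

lemma composite_in_group:
  assumes "set ts \<subseteq> reflections W"
  shows "composite ts \<in> W"
  using assms
proof (induction ts)
  case Nil
  have "composite [] = \<one>\<^bsub>general_linear\<^esub>" by (simp add: general_linear_def)
  then show ?case using subgroup.one_closed[OF subgroup] by metis
next
  case (Cons t ts)
  have "composite (t # ts) = t \<otimes>\<^bsub>general_linear\<^esub> composite ts"
    by (simp add: general_linear_def)
  moreover have "t \<in> W" "composite ts \<in> W" using Cons by (auto simp: reflections_def)
  ultimately show ?case using subgroup.m_closed[OF subgroup] by metis
qed

lemma conjugate_reflection:
  assumes ts: "set ts \<subseteq> reflections W" and a: "a \<noteq> 0" "hyperplane_reflection a \<in> reflections W"
  shows "hyperplane_reflection (composite ts a) \<in> reflections W"
proof -
  have r: "set ts \<subseteq> range hyperplane_reflection" using ts reflections_range by auto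
  have "composite (ts @ hyperplane_reflection a # rev ts) \<in> W"
    using ts a by (intro composite_in_group) auto
  moreover have "composite (ts @ hyperplane_reflection a # rev ts) = hyperplane_reflection (composite ts a)"
    using conjugate_hyperplane_reflection[OF r, of a] by (simp add: comp_assoc)
  moreover have "composite ts a \<noteq> 0"
    using norm_composite[OF r, of a] a by auto
  ultimately show ?thesis unfolding reflections_def by auto
qed

lemma reflection_conjugate_closed:
  assumes "s \<in> reflections W" "t \<in> reflections W"
  shows "t \<circ> s \<circ> t \<in> reflections W"
proof -
  obtain a where a: "a \<noteq> 0" "s = hyperplane_reflection a" using assms(1) by (rule reflectionE)
  have "t \<circ> s \<circ> t = hyperplane_reflection (t a)"
    using conjugate_hyperplane_reflection[of "[t]" a] assms(2) reflections_range by (auto simp: a)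
  then show ?thesis using conjugate_reflection[of "[t]" a] assms a by simp
qed

lemma reflection_involution:
  assumes "t \<in> reflections W"
  shows "t \<circ> t = id"
  using assms by (auto simp: reflections_def hyperplane_reflection_involution)

lemma hurwitz_move_reflections:
  assumes "set (xs @ a # b # ys) \<subseteq> reflections W"
  shows "hurwitz_move general_linear (xs @ a # b # ys) (xs @ b # (b \<circ> a \<circ> b) # ys)"
proof -
  obtain r where "b = hyperplane_reflection r" using assms by (auto elim: reflectionE)
  then have "inv\<^bsub>general_linear\<^esub> b = b" by (simp add: inv_hyperplane_reflection)
  moreover have "set (xs @ a # b # ys) \<subseteq> carrier general_linear"
    using assms reflections_carrier by auto
  ultimately show ?thesis
    using hurwitz_move.intros[of xs a b ys general_linear] by (simp add: general_linear_def)
qed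

lemma hurwitz_equiv_right:
  assumes "set (xs @ a # b # ys) \<subseteq> reflections W"
  shows "xs @ a # b # ys \<sim>\<^sub>H xs @ b # (b \<circ> a \<circ> b) # ys"
  using hurwitz_move_reflections[OF assms] by (rule r_into_equivclp)

lemma hurwitz_equiv_left:
  assumes "set (xs @ a # b # ys) \<subseteq> reflections W"
  shows "xs @ a # b # ys \<sim>\<^sub>H xs @ (a \<circ> b \<circ> a) # a # ys"
proof -
  have "a \<circ> b \<circ> a \<in> reflections W" using assms by (intro reflection_conjugate_closed) auto
  then have "hurwitz_move general_linear (xs @ (a \<circ> b \<circ> a) # a # ys) (xs @ a # (a \<circ> (a \<circ> b \<circ> a) \<circ> a) # ys)"
    using assms by (intro hurwitz_move_reflections) auto
  moreover have "a \<circ> (a \<circ> b \<circ> a) \<circ> a = (a \<circ> a) \<circ> b \<circ> (a \<circ> a)" by (simp add: comp_assoc)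
  then have "a \<circ> (a \<circ> b \<circ> a) \<circ> a = b" using reflection_involution[of a] assms by simp
  ultimately show ?thesis by (metis r_into_equivclp equivclp_sym)
qed

lemma hurwitz_move_invariants:
  assumes "hurwitz_move general_linear us vs"
  shows "length us = length vs" "set us \<subseteq> reflections W \<longleftrightarrow> set vs \<subseteq> reflections W"
    "composite us = composite vs"
    "(\<forall>t\<in>set us. t v = v) \<longleftrightarrow> (\<forall>t\<in>set vs. t v = v)"
proof -
  interpret gl: group "general_linear :: ('v \<Rightarrow> 'v) monoid" by (rule group_general_linear)
  obtain xs a b ys where e: "us = xs @ a # b # ys"
      "vs = xs @ b # (inv\<^bsub>general_linear\<^esub> b \<circ> a \<circ> b) # ys"
      and c: "a \<in> carrier general_linear" "b \<in> carrier general_linear"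
    using assms by cases (auto simp: general_linear_def)
  define c where "c = inv\<^bsub>general_linear\<^esub> b"
  have bc: "b \<circ> c = id" "c \<circ> b = id"
    using gl.r_inv[OF \<open>b \<in> _\<close>] gl.l_inv[OF \<open>b \<in> _\<close>] by (simp_all add: c_def general_linear_def)
  have cb: "c (b x) = x" "b (c x) = x" for x
    using fun_cong[OF bc(1), of x] fun_cong[OF bc(2), of x] by simp_all
  show "length us = length vs" by (simp add: e)
  show "composite us = composite vs"
    by (simp add: e comp_assoc flip: c_def) (simp add: fun_eq_iff cb)
  show "(\<forall>t\<in>set us. t v = v) \<longleftrightarrow> (\<forall>t\<in>set vs. t v = v)"
    by (auto simp: e simp flip: c_def) (metis cb)+
  have "a \<in> reflections W \<longleftrightarrow> c \<circ> a \<circ> b \<in> reflections W" if b: "b \<in> reflections W"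
  proof -
    have "c = b" using b by (auto simp: c_def inv_hyperplane_reflection elim: reflectionE)
    have "b \<circ> (b \<circ> a \<circ> b) \<circ> b = (b \<circ> b) \<circ> a \<circ> (b \<circ> b)" by (simp add: comp_assoc)
    then have "b \<circ> (b \<circ> a \<circ> b) \<circ> b = a" using reflection_involution[OF b] by simp
    then show ?thesis unfolding \<open>c = b\<close>
      using reflection_conjugate_closed[of _ b] b by metis
  qed
  then show "set us \<subseteq> reflections W \<longleftrightarrow> set vs \<subseteq> reflections W"
    by (auto simp: e simp flip: c_def)
qed

lemma hurwitz_equiv_invariants:
  assumes "us \<sim>\<^sub>H vs"
  shows "length us = length vs \<and> (set us \<subseteq> reflections W \<longleftrightarrow> set vs \<subseteq> reflections W) \<and>
    composite us = composite vs \<and>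
    ((\<forall>t\<in>set us. t v = v) \<longleftrightarrow> (\<forall>t\<in>set vs. t v = v))"
  using assms
proof (induction rule: equivclp_induct)
  case (step y z)
  from step.hyps(2) have "length y = length z \<and>
    (set y \<subseteq> reflections W \<longleftrightarrow> set z \<subseteq> reflections W) \<and> composite y = composite z \<and>
    ((\<forall>t\<in>set y. t v = v) \<longleftrightarrow> (\<forall>t\<in>set z. t v = v))"
  proof
    assume "hurwitz_move general_linear y z"
    then show ?thesis by (intro conjI hurwitz_move_invariants)
  next
    assume "hurwitz_move general_linear z y"
    note inv = hurwitz_move_invariants[OF this]
    show ?thesis by (intro conjI inv[symmetric])
  qed
  with step.IH show ?case by argo
qed simp

text \<open>Two moves carry a neighbour \<open>x\<close> to the right across \<open>t, t\<close>; it gets conjugated twice by \<open>t\<close>, that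
  is, not at all.\<close>

lemma move_pair_left:
  assumes "set (xs @ t # t # ys) \<subseteq> reflections W"
  shows "xs @ t # t # ys \<sim>\<^sub>H t # t # xs @ ys"
  using assms
proof (induction xs)
  case Nil
  show ?case by (simp add: equivclp_refl)
next
  case (Cons x xs)
  have t: "t \<circ> t = id" using Cons.prems by (intro reflection_involution) auto
  have mem: "t \<circ> x \<circ> t \<in> reflections W" using Cons.prems by (intro reflection_conjugate_closed) auto
  have "x # (xs @ t # t # ys) \<sim>\<^sub>H x # (t # t # xs @ ys)"
    using hurwitz_equiv_append[of general_linear "xs @ t # t # ys" "t # t # xs @ ys" "[x]" "[]"]
      Cons reflections_carrier by auto
  also have "x # t # t # xs @ ys \<sim>\<^sub>H t # (t \<circ> x \<circ> t) # t # xs @ ys"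
    using hurwitz_equiv_right[of "[]" x t "t # xs @ ys"] Cons.prems by auto
  also (equivclp_trans) have "t # (t \<circ> x \<circ> t) # t # xs @ ys \<sim>\<^sub>H t # t # (t \<circ> (t \<circ> x \<circ> t) \<circ> t) # xs @ ys"
    using hurwitz_equiv_right[of "[t]" "t \<circ> x \<circ> t" t "xs @ ys"] Cons.prems mem by auto
  also (equivclp_trans) have "t \<circ> (t \<circ> x \<circ> t) \<circ> t = (t \<circ> t) \<circ> x \<circ> (t \<circ> t)" by (simp add: comp_assoc)
  also have "\<dots> = x" by (simp add: t)
  finally show ?case by simp
qed


section \<open>Maximal factorizations descend\<close>

text \<open>For the initial value \<open>id\<close>, the terms are \<open>\<langle>x\<^sub>i p, p\<rangle>\<close> for the nonempty prefix products
  \<open>x\<^sub>i\<close> of the factorization; a Hurwitz move changes just one of them.\<close>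

primrec prefix_sum :: "('v::real_inner \<Rightarrow> 'v) \<Rightarrow> 'v \<Rightarrow> ('v \<Rightarrow> 'v) list \<Rightarrow> real" where
  "prefix_sum x p [] = 0"
| "prefix_sum x p (t # ts) = x (t p) \<bullet> p + prefix_sum (x \<circ> t) p ts"

lemma prefix_sum_append:
  "prefix_sum x p (xs @ ys) = prefix_sum x p xs + prefix_sum (x \<circ> composite xs) p ys"
  by (induction xs arbitrary: x) (simp_all add: comp_assoc)

text \<open>Hurwitz equivalence preserves length and membership in the finite set of reflections, so orbits
  are finite.\<close>

lemma maximal_in_orbit_exists:
  assumes "set us \<subseteq> reflections W"
  obtains vs where "us \<sim>\<^sub>H vs"
    "\<And>ws. us \<sim>\<^sub>H ws \<Longrightarrow> prefix_sum id p ws \<le> prefix_sum id p vs"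
proof -
  define Orb where "Orb = {vs. us \<sim>\<^sub>H vs}"
  have "Orb \<subseteq> {vs. set vs \<subseteq> reflections W \<and> length vs = length us}"
    using hurwitz_equiv_invariants assms by (auto simp: Orb_def)
  then have fin: "finite Orb"
    using finite_lists_length_eq[OF finite_reflections] by (rule finite_subset)
  have "us \<in> Orb" by (simp add: Orb_def equivclp_refl)
  with fin have "Max (prefix_sum id p ` Orb) \<in> prefix_sum id p ` Orb" by (intro Max_in) auto
  then obtain vs where vs: "vs \<in> Orb" "prefix_sum id p vs = Max (prefix_sum id p ` Orb)" by auto
  show ?thesis
  proof (rule that)
    show "us \<sim>\<^sub>H vs" using vs by (simp add: Orb_def)
    show "prefix_sum id p ws \<le> prefix_sum id p vs" if "us \<sim>\<^sub>H ws" for ws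
      using that fin vs(2) by (simp add: Orb_def)
  qed
qed

text \<open>The move at the place of \<open>a, b\<close> and its inverse replace the middle prefix product \<open>x\<close> by \<open>x a b\<close> and
  \<open>x b a\<close>, and no other. Writing the form \<open>x u \<bullet> p\<close> as \<open>u \<bullet> q\<close>, a valley at \<open>x\<close> means that \<open>a\<close> and \<open>b\<close> both bring
  \<open>p\<close> closer to \<open>q\<close>; then one of the rotations does so as well, and the corresponding move increases the
  sum.\<close>

lemma no_valley_if_maximal:
  assumes R: "set (xs @ a # b # ys) \<subseteq> reflections W" and "a \<noteq> b"
    and max: "\<And>ws. xs @ a # b # ys \<sim>\<^sub>H ws \<Longrightarrow>
                prefix_sum id p ws \<le> prefix_sum id p (xs @ a # b # ys)"
    and "composite (xs @ [a]) p \<bullet> p < composite xs p \<bullet> p"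
  shows "composite (xs @ [a, b]) p \<bullet> p \<le> composite (xs @ [a]) p \<bullet> p"
proof (rule ccontr)
  assume rise: "\<not> composite (xs @ [a, b]) p \<bullet> p \<le> composite (xs @ [a]) p \<bullet> p"
  obtain \<alpha> where \<alpha>: "a = hyperplane_reflection \<alpha>" using R by (auto elim: reflectionE)
  obtain \<beta> where \<beta>: "b = hyperplane_reflection \<beta>" using R by (auto elim: reflectionE)
  define x where "x = composite (xs @ [a])"
  define q where "q = composite (rev (xs @ [a])) p"
  have "set (xs @ [a]) \<subseteq> range hyperplane_reflection" using R reflections_range by auto
  then have xq: "x u \<bullet> p = u \<bullet> q" for u unfolding x_def q_def by (rule composite_adjoint)
  have xs: "composite xs u = x (a u)" for u by (simp add: x_def \<alpha>)
  have aa: "a \<circ> a = id" "b \<circ> b = id" using R by (auto intro: reflection_involution)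
  have swap: "composite xs (c p) \<bullet> p \<le> composite xs (a p) \<bullet> p"
    if "xs @ a # b # ys \<sim>\<^sub>H xs @ c # d # ys" "c \<circ> d = a \<circ> b" for c d
  proof -
    have "c (d p) = a (b p)" using fun_cong[OF that(2), of p] by (simp only: o_apply)
    then show ?thesis using max[OF that(1)] that(2) by (simp add: prefix_sum_append comp_assoc)
  qed
  have "p \<bullet> q < hyperplane_reflection \<alpha> (hyperplane_reflection \<beta> p) \<bullet> q \<or>
        p \<bullet> q < hyperplane_reflection \<beta> (hyperplane_reflection \<alpha> p) \<bullet> q"
  proof (rule rotation_beats_two_improving_reflections)
    show "hyperplane_reflection \<alpha> \<noteq> hyperplane_reflection \<beta>" using \<open>a \<noteq> b\<close> \<alpha> \<beta> by simp
    show "p \<bullet> q < hyperplane_reflection \<alpha> p \<bullet> q"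
      using assms(4) unfolding x_def[symmetric] xs xq by (simp only: \<alpha>)
    have "composite (xs @ [a, b]) p = x (b p)" by (simp add: x_def)
    then show "p \<bullet> q < hyperplane_reflection \<beta> p \<bullet> q"
      using rise unfolding x_def[symmetric] by (simp add: xq \<beta>)
  qed
  moreover have "a (b p) \<bullet> q \<le> p \<bullet> q"
  proof -
    have "b \<circ> (b \<circ> a \<circ> b) = (b \<circ> b) \<circ> a \<circ> b" by (simp add: comp_assoc)
    then show ?thesis
      using swap[OF hurwitz_equiv_right[OF R]] aa by (simp add: xs xq \<alpha>)
  qed
  moreover have "b (a p) \<bullet> q \<le> p \<bullet> q"
  proof -
    have "(a \<circ> b \<circ> a) \<circ> a = a \<circ> b \<circ> (a \<circ> a)" by (simp add: comp_assoc)
    then show ?thesis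
      using swap[OF hurwitz_equiv_left[OF R]] aa by (simp add: xs xq \<alpha>)
  qed
  ultimately show False by (auto simp: \<alpha> \<beta>)
qed

text \<open>The first step descends because \<open>id\<close> is where \<open>x p \<bullet> p\<close> is largest. After a descent the next step
  cannot ascend, as that would be a valley, nor stay level: the difference of the two values is a
  nonzero multiple of \<open>(p \<bullet> b) (y b \<bullet> p)\<close>, where \<open>b\<close> and \<open>y b\<close> are both roots of reflections in \<open>W\<close>.\<close>

lemma strict_descent_if_maximal:
  assumes R: "set us \<subseteq> reflections W"
    and sf: "\<And>xs a ys. us \<noteq> xs @ a # a # ys"
    and max: "\<And>ws. us \<sim>\<^sub>H ws \<Longrightarrow> prefix_sum id p ws \<le> prefix_sum id p us"
    and gen: "\<And>t. t \<in> reflections W \<Longrightarrow> t p \<noteq> p"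
    and us: "us = xs @ t # ys"
  shows "composite (xs @ [t]) p \<bullet> p < composite xs p \<bullet> p"
  using us
proof (induction xs arbitrary: t ys rule: rev_induct)
  case Nil
  then have t: "t \<in> reflections W" using R by auto
  then obtain b where b: "b \<noteq> 0" "t = hyperplane_reflection b" by (rule reflectionE)
  have "p \<bullet> b \<noteq> 0" using gen[OF t] by (simp add: b hyperplane_reflection_fixes_iff)
  then have "0 < (p \<bullet> b)\<^sup>2 / (b \<bullet> b)" using b by simp
  then show ?case
    by (simp add: b inner_hyperplane_reflection inner_commute[of b p] power2_eq_square)
next
  case (snoc a xs)
  have eq: "us = xs @ a # t # ys" using snoc.prems by simp
  have less: "composite (xs @ [a]) p \<bullet> p < composite xs p \<bullet> p" by (rule snoc.IH[OF eq])
  have "a \<noteq> t" using sf eq by auto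
  then have "composite (xs @ [a, t]) p \<bullet> p \<le> composite (xs @ [a]) p \<bullet> p"
    by (intro no_valley_if_maximal[where ys = ys]) (use R max less eq in auto)
  moreover have "composite (xs @ [a, t]) p \<bullet> p \<noteq> composite (xs @ [a]) p \<bullet> p"
  proof -
    define y where "y = composite (xs @ [a])"
    have xa: "set (xs @ [a]) \<subseteq> reflections W" and t: "t \<in> reflections W" using R eq by auto
    have lin: "linear y" unfolding y_def
      by (rule linear_composite) (use xa reflections_range in blast)
    obtain b where b: "b \<noteq> 0" "t = hyperplane_reflection b" using t by (rule reflectionE)
    have "hyperplane_reflection (y b) \<in> reflections W"
      unfolding y_def by (rule conjugate_reflection[OF xa]) (use b t in auto)
    then have "y b \<bullet> p \<noteq> 0"
      using gen hyperplane_reflection_fixes_iff[of "y b" p] by (auto simp: inner_commute)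
    moreover have "p \<bullet> b \<noteq> 0" using gen[OF t] by (simp add: b hyperplane_reflection_fixes_iff)
    moreover have "y (t p) = y p - (2 * (p \<bullet> b) / (b \<bullet> b)) *\<^sub>R y b"
      by (simp add: b hyperplane_reflection_def linear_diff[OF lin] linear_scale[OF lin])
    ultimately have "y (t p) \<bullet> p \<noteq> y p \<bullet> p" using b by (simp add: inner_diff_left)
    then show ?thesis by (simp add: y_def)
  qed
  ultimately show ?case by simp
qed

section \<open>Square-free orbits\<close>

definition square_free_orbit :: "('v \<Rightarrow> 'v) list \<Rightarrow> bool" where
  "square_free_orbit us \<longleftrightarrow> (\<forall>xs a ys. \<not> us \<sim>\<^sub>H xs @ a # a # ys)"

text \<open>The vector \<open>p\<close> is taken off all mirrors and so close to \<open>v\<close> that the elements moving \<open>v\<close> have a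
  smaller value of \<open>x p \<bullet> p\<close> than \<open>w\<close>. This works because \<open>x v \<bullet> v < v \<bullet> v = w v \<bullet> v\<close> for these elements, by
  the equality case of the Cauchy-Schwarz inequality for vectors of equal norm. The descent along a maximal factorization then
  keeps all prefix products among the elements that fix \<open>v\<close>.\<close>

lemma reflections_fix_fixed_vectors:
  assumes R: "set us \<subseteq> reflections W" and sf: "square_free_orbit us"
    and v: "composite us v = v"
  shows "\<forall>t\<in>set us. t v = v"
proof -
  define w where "w = composite us"
  define X where "X = {x \<in> W. (\<exists>ts. set ts \<subseteq> reflections W \<and> x = composite ts) \<and> x v \<noteq> v}"
  define U where "U = (\<Inter>x\<in>X. {p. x p \<bullet> p < w p \<bullet> p})"
  have cont: "continuous_on UNIV (composite ts)" if "set ts \<subseteq> reflections W" for ts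
    by (rule continuous_composite) (use that reflections_range in blast)
  have "open U" unfolding U_def
  proof (intro open_INT ballI)
    show "finite X" using finite by (simp add: X_def)
    fix x assume "x \<in> X"
    then have "continuous_on UNIV x" using cont by (auto simp: X_def)
    then show "open {p. x p \<bullet> p < w p \<bullet> p}"
      using cont[OF R] by (intro open_Collect_less continuous_on_inner continuous_on_id) (simp_all add: w_def)
  qed
  moreover have "v \<in> U" unfolding U_def
  proof (intro INT_I CollectI)
    fix x assume "x \<in> X"
    then obtain ts where ts: "set ts \<subseteq> reflections W" "x = composite ts" "x v \<noteq> v" by (auto simp: X_def)
    have "norm (x v) = norm v"
      unfolding ts(2) by (rule norm_composite) (use ts reflections_range in blast)
    then have "x v \<bullet> x v = v \<bullet> v" by (simp add: norm_eq_sqrt_inner)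
    moreover have "0 < (x v - v) \<bullet> (x v - v)" using ts(3) by simp
    ultimately have "x v \<bullet> v < v \<bullet> v"
      by (simp add: inner_diff_left inner_diff_right inner_commute)
    then show "x v \<bullet> v < w v \<bullet> v" by (simp add: w_def v)
  qed
  moreover obtain \<rho> where \<rho>: "\<And>t. t \<in> reflections W \<Longrightarrow> \<rho> t \<noteq> 0 \<and> t = hyperplane_reflection (\<rho> t)"
    using bchoice[of "reflections W" "\<lambda>t b. b \<noteq> 0 \<and> t = hyperplane_reflection b"]
    by (auto simp: reflections_def)
  moreover have "finite (\<rho> ` reflections W)" "0 \<notin> \<rho> ` reflections W"
    using finite_reflections \<rho> by force+
  ultimately obtain p where p: "p \<in> U" "\<forall>b\<in>\<rho> ` reflections W. p \<bullet> b \<noteq> 0"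
    using generic_vector_exists by metis
  have gen: "t p \<noteq> p" if "t \<in> reflections W" for t
    using p(2) \<rho>[OF that] that hyperplane_reflection_fixes_iff[of "\<rho> t" p] by auto
  obtain vs where vs: "us \<sim>\<^sub>H vs"
    "\<And>ws. us \<sim>\<^sub>H ws \<Longrightarrow> prefix_sum id p ws \<le> prefix_sum id p vs"
    using maximal_in_orbit_exists[OF R, of p] by blast
  have Rvs: "set vs \<subseteq> reflections W" and wvs: "composite vs = w"
    using hurwitz_equiv_invariants[OF vs(1)] R by (auto simp: w_def)
  have desc: "composite (xs @ [t]) p \<bullet> p < composite xs p \<bullet> p" if "vs = xs @ t # ys" for xs t ys
  proof (rule strict_descent_if_maximal[OF Rvs])
    show "vs = xs @ t # ys" by (rule that)
    show "s p \<noteq> p" if "s \<in> reflections W" for s by (rule gen[OF that])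
    show "vs \<noteq> xs @ a # a # ys" for xs a ys
      using sf vs(1) by (auto simp: square_free_orbit_def)
    show "prefix_sum id p ws \<le> prefix_sum id p vs" if "vs \<sim>\<^sub>H ws" for ws
      using vs(2)[OF equivclp_trans[OF vs(1) that]] .
  qed
  have le: "w p \<bullet> p \<le> composite xs p \<bullet> p" if "vs = xs @ ys" for xs ys
    using that
  proof (induction ys arbitrary: xs)
    case Nil
    then show ?case using wvs by simp
  next
    case (Cons t ys)
    have "w p \<bullet> p \<le> composite (xs @ [t]) p \<bullet> p" by (rule Cons.IH) (use Cons.prems in simp)
    also have "\<dots> < composite xs p \<bullet> p" by (rule desc[OF Cons.prems])
    finally show ?case by simp
  qed
  have prefix_fixes: "composite xs v = v" if "vs = xs @ ys" for xs ys
  proof (rule ccontr)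
    assume "composite xs v \<noteq> v"
    moreover have "set xs \<subseteq> reflections W" using Rvs that by auto
    ultimately have "composite xs \<in> X" using composite_in_group[of xs] by (auto simp: X_def)
    then have "composite xs p \<bullet> p < w p \<bullet> p" using p(1) by (auto simp: U_def)
    with le[OF that] show False by simp
  qed
  have "t v = v" if t: "t \<in> set vs" for t
  proof -
    obtain xs ys where s: "vs = xs @ t # ys" using split_list[OF t] by blast
    have "composite xs (t v) = v" using prefix_fixes[of "xs @ [t]" ys] s by simp
    then have "composite xs (t v - v) = 0"
      using prefix_fixes[OF s] linear_diff[OF linear_composite, of xs "t v" v] Rvs s reflections_range
      by auto
    moreover have "norm (composite xs (t v - v)) = norm (t v - v)"
      by (rule norm_composite) (use Rvs s reflections_range in auto)
    ultimately show ?thesis by simp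
  qed
  then show ?thesis using hurwitz_equiv_invariants[OF vs(1), of v] by blast
qed

lemma square_free_orbit_butlast:
  assumes "square_free_orbit (us @ [t])" "t \<in> reflections W"
  shows "square_free_orbit us"
  unfolding square_free_orbit_def
proof (intro allI notI)
  fix xs a ys assume "us \<sim>\<^sub>H xs @ a # a # ys"
  then have "[] @ us @ [t] \<sim>\<^sub>H [] @ (xs @ a # a # ys) @ [t]"
    by (rule hurwitz_equiv_append) (use assms(2) reflections_carrier in auto)
  with assms(1) show False by (auto simp: square_free_orbit_def)
qed

text \<open>If the new root \<open>b\<close> depended linearly on the earlier ones, it would lie in the image of \<open>w\<^sub>0 - 1\<close>
  for the product \<open>w\<^sub>0\<close> of the earlier reflections. Then the whole product would fix a vector that the
  reflection in \<open>b\<close> moves.\<close>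

lemma roots_of_square_free_orbit:
  assumes "set (map hyperplane_reflection as) \<subseteq> reflections W" "0 \<notin> set as"
    and "square_free_orbit (map hyperplane_reflection as)"
  shows "independent (set as) \<and> distinct as \<and>
    set as \<subseteq> range (\<lambda>x. composite (map hyperplane_reflection as) x - x)"
  using assms
proof (induction as rule: rev_induct)
  case Nil
  then show ?case by (simp add: independent_empty)
next
  case (snoc b as)
  let ?w = "composite (map hyperplane_reflection as)"
  have r: "set (map hyperplane_reflection as) \<subseteq> range hyperplane_reflection" by auto
  have IH: "independent (set as)" "distinct as" "set as \<subseteq> range (\<lambda>x. ?w x - x)"
    using snoc.IH snoc.prems square_free_orbit_butlast by auto
  have "b \<noteq> 0" using snoc.prems by auto
  have b: "b \<notin> span (set as)"
  proof
    assume "b \<in> span (set as)"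
    moreover have "subspace (range (\<lambda>x. ?w x - x))"
      by (rule linear_subspace_image[OF _ subspace_UNIV])
         (intro linear_compose_sub linear_composite[OF r] linear_ident)
    ultimately have "b \<in> range (\<lambda>x. ?w x - x)" using span_minimal[OF IH(3)] by blast
    then obtain x where x: "b = ?w x - x" by blast
    have fx: "?w (hyperplane_reflection b (?w x)) = ?w x" and ne: "?w x \<bullet> b = (b \<bullet> b) / 2"
      using new_fixed_vector_of_root_in_image[OF r x] by auto
    have "\<forall>t\<in>set (map hyperplane_reflection (as @ [b])). t (?w x) = ?w x"
      by (rule reflections_fix_fixed_vectors[OF snoc.prems(1,3)]) (simp add: fx)
    then have "?w x \<bullet> b = 0" by (simp add: hyperplane_reflection_fixes_iff)
    with ne \<open>b \<noteq> 0\<close> show False by simp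
  qed
  moreover have "b \<notin> set as" using b span_base by blast
  ultimately show ?case
    using IH roots_in_image_step[OF IH(3) b] by (simp add: independent_insert)
qed

lemma roots_of_reflections:
  assumes "set ts \<subseteq> reflections W"
  obtains as where "ts = map hyperplane_reflection as" "0 \<notin> set as"
proof -
  have "\<exists>as. ts = map hyperplane_reflection as \<and> 0 \<notin> set as"
    using assms
  proof (induction ts)
    case (Cons t ts)
    then obtain as where "ts = map hyperplane_reflection as" "0 \<notin> set as" by auto
    moreover obtain a where "a \<noteq> 0" "t = hyperplane_reflection a"
      using Cons.prems by (auto elim: reflectionE)
    ultimately show ?case by (intro exI[of _ "a # as"]) auto
  qed simp
  then show ?thesis using that by blast
qed

lemma length_of_square_free_orbit:
  assumes R: "set us \<subseteq> reflections W" and sf: "square_free_orbit us"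
  shows "reflection_length W (composite us) = length us"
  unfolding reflection_length_def
proof (rule Least_equality)
  show "\<exists>ts. length ts = length us \<and> reflection_factorization W (composite us) ts"
    using R by (auto simp: reflection_factorization_def composite_def)
next
  fix k assume "\<exists>ts. length ts = k \<and> reflection_factorization W (composite us) ts"
  then obtain ts where ts: "length ts = k" "set ts \<subseteq> reflections W" "composite us = composite ts"
    by (auto simp: reflection_factorization_def composite_def)
  obtain as where as: "us = map hyperplane_reflection as" "0 \<notin> set as"
    using R by (rule roots_of_reflections)
  obtain bs where bs: "ts = map hyperplane_reflection bs" "0 \<notin> set bs"
    using ts(2) by (rule roots_of_reflections)
  have "length as \<le> length bs"
    using roots_of_square_free_orbit[of as] R sf ts(3) as bs
    by (intro length_le_of_independent_roots) auto
  then show "length us \<le> k" using as bs ts by simp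
qed

section \<open>Splitting off equal pairs\<close>

lemma hurwitz_normal_form:
  assumes "set us \<subseteq> reflections W"
  defines "l \<equiv> reflection_length W (composite us)"
  shows "l \<le> length us \<and> even (length us - l) \<and> (\<exists>ts. ts \<sim>\<^sub>H us \<and>
    (\<forall>i. 2 * i + 1 < length us - l \<longrightarrow> ts ! (2 * i) = ts ! (2 * i + 1)) \<and>
    composite (drop (length us - l) ts) = composite us)"
  using assms(1) unfolding l_def
proof (induction "length us" arbitrary: us rule: less_induct)
  case less
  show ?case
  proof (cases "square_free_orbit us")
    case True
    show ?thesis
      using length_of_square_free_orbit[OF less.prems True]
      by (auto intro!: exI[of _ us] equivclp_refl)
  next
    case False
    then obtain xs a ys where us: "us \<sim>\<^sub>H xs @ a # a # ys" by (auto simp: square_free_orbit_def)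
    note inv = hurwitz_equiv_invariants[OF us]
    have R: "set (xs @ a # a # ys) \<subseteq> reflections W" using inv less.prems by simp
    have a: "a \<circ> a = id" by (rule reflection_involution) (use R in auto)
    have len: "length us = Suc (Suc (length (xs @ ys)))" using inv by simp
    have "a \<circ> (a \<circ> composite ys) = (a \<circ> a) \<circ> composite ys" by (simp add: comp_assoc)
    then have comp: "composite (xs @ ys) = composite us" using inv by (simp add: a)
    define k where "k = length (xs @ ys) - reflection_length W (composite us)"
    have "length (xs @ ys) < length us" "set (xs @ ys) \<subseteq> reflections W" using len R by auto
    from less.hyps[OF this] obtain ts where l: "reflection_length W (composite us) \<le> length (xs @ ys)"
      and k: "even k" and ts: "ts \<sim>\<^sub>H xs @ ys"
        "\<And>i. 2 * i + 1 < k \<Longrightarrow> ts ! (2 * i) = ts ! (2 * i + 1)"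
        "composite (drop k ts) = composite us"
      unfolding comp k_def by blast
    have k': "length us - reflection_length W (composite us) = Suc (Suc k)"
      using l len by (simp add: k_def)
    have "[a, a] @ ts @ [] \<sim>\<^sub>H [a, a] @ (xs @ ys) @ []"
      by (rule hurwitz_equiv_append[OF ts(1)]) (use R reflections_carrier in auto)
    also have "\<dots> \<sim>\<^sub>H xs @ a # a # ys"
      using equivclp_sym[OF move_pair_left[OF R]] by simp
    also (equivclp_trans) have "\<dots> \<sim>\<^sub>H us" using us by (rule equivclp_sym)
    finally (equivclp_trans) have "a # a # ts \<sim>\<^sub>H us" by simp
    moreover have "(a # a # ts) ! (2 * i) = (a # a # ts) ! (2 * i + 1)"
      if "2 * i + 1 < Suc (Suc k)" for i
      using that ts(2)[of "i - 1"] by (cases i) auto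
    moreover have "composite (drop (Suc (Suc k)) (a # a # ts)) = composite us" using ts(3) by simp
    ultimately show ?thesis unfolding k' using k l len by auto
  qed
qed

end

theorem corollary1p4:
  fixes W :: "('v::real_inner \<Rightarrow> 'v) set"
    and w :: "'v \<Rightarrow> 'v"
    and us :: "('v \<Rightarrow> 'v) list"
    and l m :: nat
  assumes "finite_reflection_group W"
    and "w \<in> W"
    and "reflection_length W w = l"
    and "reflection_factorization W w us"
    and "length us = m"
  shows "\<exists>ts. length ts = m \<and> set ts \<subseteq> reflections W \<and>
           us \<in> hurwitz_orbit general_linear ts \<and>
           even (m - l) \<and>
           (\<forall>i. 2 * i + 1 < m - l \<longrightarrow> ts ! (2 * i) = ts ! (2 * i + 1)) \<and>
           shortest_reflection_factorization W w (drop (m - l) ts)"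
proof -
  interpret finite_linear_group W
    by (rule finite_linear_group.intro)
       (use assms(1) in \<open>auto simp: finite_reflection_group_def\<close>)
  have R: "set us \<subseteq> reflections W" and w: "composite us = w"
    using assms(4) by (auto simp: reflection_factorization_def composite_def)
  obtain ts where l: "l \<le> m" "even (m - l)"
    and ts: "equivclp (hurwitz_move general_linear) ts us"
      "\<forall>i. 2 * i + 1 < m - l \<longrightarrow> ts ! (2 * i) = ts ! (2 * i + 1)"
      "composite (drop (m - l) ts) = w"
    using hurwitz_normal_form[OF R] unfolding w assms(3,5) by blast
  have len: "length ts = m" and Rts: "set ts \<subseteq> reflections W"
    using hurwitz_equiv_invariants[OF ts(1)] R assms(5) by auto
  have "shortest_reflection_factorization W w (drop (m - l) ts)"
    using ts(3) Rts len l assms(3) set_drop_subset[of "m - l" ts]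
    by (auto simp: shortest_reflection_factorization_def reflection_factorization_def composite_def)
  with len Rts ts l(2) show ?thesis by (auto simp: hurwitz_orbit_def)
qed

end
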